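(* Let $F$ be a field of characteristic not two. Nishida nilpotence holds in all non-negative degrees of the Milnor–Witt $K$-ring $K^{MW}_*(F)$, i.e. for every $n\geq 0$ every torsion element of $K^{MW}_n(F)$ is nilpotent in $K^{MW}_*(F)$. Nishida nilpotence holds in all degrees of $K^{MW}_*(F)$ (i.e. for every $n\in\mathbb{Z}$ every torsion element of $K^{MW}_n(F)$ is nilpotent) if and only if $F$ is formally real.
   Context: Nishida nilpotence is said to hold in a given degree of a graded ring if every (additive) torsion element in that degree is nilpotent. $K^{MW}_*(F)$ is Morel's Milnor–Witt $K$-ring: the graded associative unital ring generated by symbols $[a]$ of degree $1$ for $a\in F^\times$ and an element $\eta$ of degree $-1$, subject to the relations $[a][1-a]=0$ for $a\neq 0,1$; $[ab]=[a]+[b]+\eta[a][b]$; $\eta[a]=[a]\eta$; and $\eta(\eta[-1]+2)=0$. A field is formally real if it admits an ordering, equivalently if $-1$ is not a sum of squares. *)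

theory Defs
  imports "HOL-Library.Poly_Mapping" "HOL-Computational_Algebra.Computational_Algebra"
begin

section \<open>Free associative unital rings\<close>

text \<open>
  The free associative unital ring on a type of generators is the integral monoid ring of the
  free monoid. The type of words is a copy of the list type with concatenation written
  additively, because the convolution product on \<open>\<Rightarrow>\<^sub>0\<close> is based on an additive monoid.
\<close>

datatype 'g gen_word = Gen_Word (letters: "'g list")

instantiation gen_word :: (type) monoid_add
begin

definition zero_gen_word :: "'a gen_word" where
  "0 = Gen_Word []"

definition plus_gen_word :: "'a gen_word \<Rightarrow> 'a gen_word \<Rightarrow> 'a gen_word" where
  "u + v = Gen_Word (letters u @ letters v)"

instance
  by standard (simp_all add: zero_gen_word_def plus_gen_word_def)

end

type_synonym 'g free_ring = "'g gen_word \<Rightarrow>\<^sub>0 int"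

definition generator :: "'g \<Rightarrow> 'g free_ring" where
  "generator g = Poly_Mapping.single (Gen_Word [g]) 1"

inductive_set two_sided_ideal :: "'r::ring_1 set \<Rightarrow> 'r set" for S where
  base: "x \<in> S \<Longrightarrow> x \<in> two_sided_ideal S"
| zero: "0 \<in> two_sided_ideal S"
| add: "x \<in> two_sided_ideal S \<Longrightarrow> y \<in> two_sided_ideal S \<Longrightarrow> x + y \<in> two_sided_ideal S"
| mult: "x \<in> two_sided_ideal S \<Longrightarrow> l * x * r \<in> two_sided_ideal S"

lemma two_sided_ideal_mult_left: "x \<in> two_sided_ideal S \<Longrightarrow> l * x \<in> two_sided_ideal S"
  using two_sided_ideal.mult[of x S l 1] by simp

lemma two_sided_ideal_mult_right: "x \<in> two_sided_ideal S \<Longrightarrow> x * r \<in> two_sided_ideal S"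
  using two_sided_ideal.mult[of x S 1 r] by simp

lemma two_sided_ideal_uminus: "x \<in> two_sided_ideal S \<Longrightarrow> - x \<in> two_sided_ideal S"
  using two_sided_ideal_mult_left[of x S "- 1"] by simp


section \<open>The Milnor--Witt K-ring\<close>

typedef (overloaded) 'a nonzero = "{a::'a::field. a \<noteq> 0}"
  by (rule exI[of _ 1]) simp

datatype 'u mw_generator = Symbol 'u | Eta

text \<open>\<open>mw_symbol a\<close> is the generator $[a]$; it is meaningful only for \<open>a \<noteq> 0\<close>.\<close>

definition mw_symbol :: "'a::field \<Rightarrow> 'a nonzero mw_generator free_ring" where
  "mw_symbol a = generator (Symbol (Abs_nonzero a))"

definition mw_eta :: "'a::field nonzero mw_generator free_ring" where
  "mw_eta = generator Eta"

inductive_set mw_relations :: "'a::field nonzero mw_generator free_ring set" where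
  steinberg: "a \<noteq> 0 \<Longrightarrow> a \<noteq> 1 \<Longrightarrow> mw_symbol a * mw_symbol (1 - a) \<in> mw_relations"
| twisted_log: "a \<noteq> 0 \<Longrightarrow> b \<noteq> 0 \<Longrightarrow>
    mw_symbol (a * b) - (mw_symbol a + mw_symbol b + mw_eta * mw_symbol a * mw_symbol b) \<in> mw_relations"
| eta_central: "a \<noteq> 0 \<Longrightarrow> mw_eta * mw_symbol a - mw_symbol a * mw_eta \<in> mw_relations"
| eta_hyperbolic: "mw_eta * (mw_eta * mw_symbol (- 1) + 2) \<in> mw_relations"

definition mw_cong :: "'a::field nonzero mw_generator free_ring \<Rightarrow> 'a nonzero mw_generator free_ring \<Rightarrow> bool" where
  "mw_cong x y \<longleftrightarrow> x - y \<in> two_sided_ideal mw_relations"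

lemma equivp_mw_cong:
  "equivp (mw_cong :: 'a::field nonzero mw_generator free_ring \<Rightarrow> _)"
proof (intro equivpI reflpI sympI transpI)
  fix x y z :: "'a nonzero mw_generator free_ring"
  show "mw_cong x x"
    by (simp add: mw_cong_def two_sided_ideal.zero)
  show "mw_cong y x" if "mw_cong x y"
    using two_sided_ideal_uminus[of "x - y" mw_relations] that by (simp add: mw_cong_def)
  show "mw_cong x z" if "mw_cong x y" "mw_cong y z"
    using two_sided_ideal.add[of "x - y" mw_relations "y - z"] that by (simp add: mw_cong_def)
qed

quotient_type (overloaded) 'a milnor_witt = "'a::field nonzero mw_generator free_ring" / mw_cong
  by (rule equivp_mw_cong)

text \<open>
  The class \<open>ring_1\<close> contains \<open>0 \<noteq> 1\<close>. It holds here because all relations have constant term 0,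
  and the constant term is multiplicative.
\<close>

lemma gen_word_plus_eq_0_iff: "u + v = 0 \<longleftrightarrow> u = 0 \<and> v = (0 :: 'g gen_word)"
  by (cases u; cases v) (simp add: zero_gen_word_def plus_gen_word_def)

lemma lookup_times_0:
  fixes x y :: "'g free_ring"
  shows "Poly_Mapping.lookup (x * y) 0 = Poly_Mapping.lookup x 0 * Poly_Mapping.lookup y 0"
proof -
  have *: "(0 = u + v) \<longleftrightarrow> v = 0 \<and> u = 0" for u v :: "'g gen_word"
    using gen_word_plus_eq_0_iff[of u v] by auto
  have "Poly_Mapping.lookup (x * y) 0 = Sum_any (\<lambda>u. Poly_Mapping.lookup x u *
      Sum_any (\<lambda>v. (Poly_Mapping.lookup y v when u = 0) when v = 0))"
    by (simp add: times_poly_mapping.rep_eq prod_fun_def * when_when flip: when_when conj_commute)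
  also have "\<dots> = Sum_any (\<lambda>u. Poly_Mapping.lookup x u * Poly_Mapping.lookup y 0 when u = 0)"
    by (simp add: mult_when)
  finally show ?thesis
    by simp
qed

lemma lookup_generator_0: "Poly_Mapping.lookup (generator g) 0 = 0"
  by (simp add: generator_def lookup_single when_def zero_gen_word_def)

lemma lookup_mw_ideal_0:
  "x \<in> two_sided_ideal (mw_relations :: 'a::field nonzero mw_generator free_ring set) \<Longrightarrow> Poly_Mapping.lookup x 0 = 0"
proof (induction rule: two_sided_ideal.induct)
  case (base x)
  then show ?case
    by cases (simp_all add: lookup_times_0 lookup_generator_0 mw_symbol_def mw_eta_def lookup_minus lookup_add)
qed (simp_all add: lookup_times_0 lookup_add)

instantiation milnor_witt :: (field) ring_1
begin

lift_definition zero_milnor_witt :: "'a milnor_witt" is 0 .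

lift_definition one_milnor_witt :: "'a milnor_witt" is 1 .

lift_definition plus_milnor_witt :: "'a milnor_witt \<Rightarrow> 'a milnor_witt \<Rightarrow> 'a milnor_witt" is "(+)"
proof -
  fix x x' y y' :: "'a nonzero mw_generator free_ring"
  assume "mw_cong x x'" "mw_cong y y'"
  then have "(x - x') + (y - y') \<in> two_sided_ideal mw_relations"
    unfolding mw_cong_def by (rule two_sided_ideal.add)
  then show "mw_cong (x + y) (x' + y')"
    by (simp add: mw_cong_def algebra_simps)
qed

lift_definition uminus_milnor_witt :: "'a milnor_witt \<Rightarrow> 'a milnor_witt" is uminus
proof -
  fix x x' :: "'a nonzero mw_generator free_ring"
  assume "mw_cong x x'"
  then have "- (x - x') \<in> two_sided_ideal mw_relations"
    unfolding mw_cong_def by (rule two_sided_ideal_uminus)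
  then show "mw_cong (- x) (- x')"
    by (simp add: mw_cong_def)
qed

lift_definition minus_milnor_witt :: "'a milnor_witt \<Rightarrow> 'a milnor_witt \<Rightarrow> 'a milnor_witt" is "(-)"
proof -
  fix x x' y y' :: "'a nonzero mw_generator free_ring"
  assume "mw_cong x x'" "mw_cong y y'"
  then have "(x - x') + - (y - y') \<in> two_sided_ideal mw_relations"
    unfolding mw_cong_def by (intro two_sided_ideal.add two_sided_ideal_uminus)
  then show "mw_cong (x - y) (x' - y')"
    by (simp add: mw_cong_def algebra_simps)
qed

lift_definition times_milnor_witt :: "'a milnor_witt \<Rightarrow> 'a milnor_witt \<Rightarrow> 'a milnor_witt" is "(*)"
proof -
  fix x x' y y' :: "'a nonzero mw_generator free_ring"
  assume "mw_cong x x'" "mw_cong y y'"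
  then have "(x - x') * y + x' * (y - y') \<in> two_sided_ideal mw_relations"
    unfolding mw_cong_def
    by (intro two_sided_ideal.add two_sided_ideal_mult_left two_sided_ideal_mult_right)
  then show "mw_cong (x * y) (x' * y')"
    by (simp add: mw_cong_def algebra_simps)
qed

instance
proof
  show "(0 :: 'a milnor_witt) \<noteq> 1"
    by transfer (auto simp: mw_cong_def lookup_one dest: lookup_mw_ideal_0)
qed (transfer; simp add: mw_cong_def algebra_simps two_sided_ideal.zero)+

end


section \<open>The grading\<close>

fun mw_generator_degree :: "'u mw_generator \<Rightarrow> int" where
  "mw_generator_degree (Symbol a) = 1"
| "mw_generator_degree Eta = - 1"

definition mw_word_degree :: "'u mw_generator gen_word \<Rightarrow> int" where
  "mw_word_degree w = (\<Sum>g\<leftarrow>letters w. mw_generator_degree g)"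

text \<open>
  The relations are homogeneous, so the quotient is graded by the images of the homogeneous
  components of the free ring.
\<close>

definition KMW :: "int \<Rightarrow> 'a::field milnor_witt set" where
  "KMW n = abs_milnor_witt ` {x. \<forall>w \<in> Poly_Mapping.keys x. mw_word_degree w = n}"


section \<open>Nishida nilpotence and formally real fields\<close>

definition torsion_element :: "'r::ring_1 \<Rightarrow> bool" where
  "torsion_element x \<longleftrightarrow> (\<exists>m::nat. m > 0 \<and> of_nat m * x = 0)"

definition nilpotent_element :: "'r::ring_1 \<Rightarrow> bool" where
  "nilpotent_element x \<longleftrightarrow> (\<exists>k::nat. x ^ k = 0)"

text \<open>A graded ring is given by its family of homogeneous components.\<close>

definition nishida_nilpotence :: "(int \<Rightarrow> 'r::ring_1 set) \<Rightarrow> int \<Rightarrow> bool" where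
  "nishida_nilpotence A n \<longleftrightarrow> (\<forall>x \<in> A n. torsion_element x \<longrightarrow> nilpotent_element x)"

definition formally_real :: "'a::field itself \<Rightarrow> bool" where
  "formally_real _ \<longleftrightarrow> (\<exists>(le :: 'a \<Rightarrow> 'a \<Rightarrow> bool) lt. class.linorder le lt \<and>
     (\<forall>a b c. le a b \<longrightarrow> le (c + a) (c + b)) \<and>
     (\<forall>a b. le 0 a \<longrightarrow> le 0 b \<longrightarrow> le 0 (a * b)))"

end

theory Submission
  imports Defs "HOL-Library.Z2"
begin

text \<open>
  A torsion element $x$ is nilpotent once it lies in every suitably prime ideal \<open>P\<close>, by Zorn's
  lemma. The identity $[a]([a]-[-1])=0$ shows that each $[a]$ is congruent to $0$ or to $[-1]$
  modulo \<open>P\<close>. If $[-1]\notin P$, then $h=\eta[-1]+2$ lies in \<open>P\<close>, and the $a$ with $[a]\in P$ are the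
  positive elements of an ordering of \<open>F\<close>. The signature of this ordering ($\eta\mapsto 1$, $[a]\mapsto 0$
  or $-2$) kills $x$ and detects the integer $c$ for which $x$ is congruent to $c[-1]^n$ or
  $c\eta^{-n}$, so that $c=0$. If $[-1]\in P$, then all $[a]$ lie in \<open>P\<close>. Degrees $n>0$ are then trivial,
  degree $0$ is settled by the rank homomorphism $\eta,[a]\mapsto 0$, and in degrees $n<0$ any signature
  shows that $c$ is even, while $2\eta\in P$.

  If \<open>F\<close> is not formally real, then no such ideal avoids all $2^k\eta^j$, as it would have to contain
  $h$ but not $[-1]$. Hence some $\eta^j$ is torsion, and it is not nilpotent because $\eta\mapsto 1$,
  $[a]\mapsto 0$ defines a homomorphism to $\mathbb{Z}/2$.
\<close>

section \<open>Ideals avoiding a multiplicative set\<close>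

definition ring_ideal :: "'r::ring_1 set \<Rightarrow> bool" where
  "ring_ideal I \<longleftrightarrow> 0 \<in> I \<and> (\<forall>x\<in>I. \<forall>y\<in>I. x + y \<in> I) \<and> (\<forall>x\<in>I. \<forall>l r. l * x * r \<in> I)"

lemma ring_ideal_zero: "ring_ideal I \<Longrightarrow> 0 \<in> I"
  and ring_ideal_add: "ring_ideal I \<Longrightarrow> x \<in> I \<Longrightarrow> y \<in> I \<Longrightarrow> x + y \<in> I"
  and ring_ideal_mult: "ring_ideal I \<Longrightarrow> x \<in> I \<Longrightarrow> l * x * r \<in> I"
  by (auto simp: ring_ideal_def)

lemma ring_ideal_left: "ring_ideal I \<Longrightarrow> x \<in> I \<Longrightarrow> l * x \<in> I"
  using ring_ideal_mult[of I x l 1] by simp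

lemma ring_ideal_right: "ring_ideal I \<Longrightarrow> x \<in> I \<Longrightarrow> x * r \<in> I"
  using ring_ideal_mult[of I x 1 r] by simp

lemma ring_ideal_uminus: "ring_ideal I \<Longrightarrow> x \<in> I \<Longrightarrow> - x \<in> I"
  using ring_ideal_left[of I x "- 1"] by simp

lemma ring_ideal_diff: "ring_ideal I \<Longrightarrow> x \<in> I \<Longrightarrow> y \<in> I \<Longrightarrow> x - y \<in> I"
  using ring_ideal_add[of I x "- y"] ring_ideal_uminus[of I y] by simp

lemma ring_ideal_cong:
  assumes "ring_ideal I" "x - y \<in> I"
  shows "x \<in> I \<longleftrightarrow> y \<in> I"
  using ring_ideal_add[OF assms(1,2), of y] ring_ideal_diff[OF assms(1), of x "x - y"] assms(2)
  by auto

lemma ring_ideal_Int: "ring_ideal I \<Longrightarrow> ring_ideal J \<Longrightarrow> ring_ideal (I \<inter> J)"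
  by (auto simp: ring_ideal_def)

lemma ring_ideal_two_sided_ideal: "ring_ideal (two_sided_ideal S)"
  by (auto simp: ring_ideal_def intro: two_sided_ideal.intros)

text \<open>The noncommutative form of (P + (u))(P + (v)) \<subseteq> P. Keeping r arbitrary in both
  inductions lets it absorb the multipliers that appear between the two factors.\<close>

lemma two_sided_ideal_normal:
  assumes "ring_ideal P" "x \<in> two_sided_ideal (insert u P)" "y \<in> two_sided_ideal (insert v P)"
    and uv: "\<And>r. u * r * v \<in> P"
  shows "x * y \<in> P"
proof -
  have 1: "u * r * y \<in> P" for r
    using assms(3)
  proof (induction arbitrary: r rule: two_sided_ideal.induct)
    case (base x)
    then show ?case using uv ring_ideal_left[OF assms(1)] by auto
  next
    case (mult x l s)
    then show ?case
      using ring_ideal_right[OF assms(1) mult.IH[of "r * l"], of s] by (simp add: mult.assoc)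
  qed (auto simp: distrib_left ring_ideal_zero[OF assms(1)] ring_ideal_add[OF assms(1)])
  have "x * r * y \<in> P" for r
    using assms(2)
  proof (induction arbitrary: r rule: two_sided_ideal.induct)
    case (base x)
    then show ?case using 1 ring_ideal_right[OF assms(1)] by (auto simp: mult.assoc)
  next
    case (mult x l s)
    then show ?case
      using ring_ideal_left[OF assms(1) mult.IH[of "s * r"], of l] by (simp add: mult.assoc)
  qed (auto simp: distrib_right ring_ideal_zero[OF assms(1)] ring_ideal_add[OF assms(1)])
  from this[of 1] show ?thesis by simp
qed

text \<open>With u * r = s * u, membership of u * v in P passes to u * r * v = s * (u * v), which is
  the hypothesis of \<open>two_sided_ideal_normal\<close>.\<close>

definition normal_element :: "'r::ring_1 \<Rightarrow> bool" where
  "normal_element u \<longleftrightarrow> (\<forall>r. \<exists>s. u * r = s * u)"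

text \<open>
  The Milnor--Witt K-ring is not commutative, but its generators are normal elements, and a
  primality condition restricted to these replaces prime ideals.
\<close>

definition normal_prime_ideal :: "'r::ring_1 set \<Rightarrow> bool" where
  "normal_prime_ideal P \<longleftrightarrow> ring_ideal P \<and>
    (\<forall>u v. normal_element u \<longrightarrow> u * v \<in> P \<longrightarrow> u \<in> P \<or> v \<in> P)"

lemma normal_prime_ideal_ideal: "normal_prime_ideal P \<Longrightarrow> ring_ideal P"
  and normal_prime_idealD:
    "normal_prime_ideal P \<Longrightarrow> normal_element u \<Longrightarrow> u * v \<in> P \<Longrightarrow> u \<in> P \<or> v \<in> P"
  by (auto simp: normal_prime_ideal_def)

text \<open>Krull's argument with P maximal among the ideals disjoint from M. If u and v lay outside
  P, the ideals generated by P with u and by P with v would meet M in some m and n, and m * n would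
  lie in both P and M.\<close>

lemma exists_normal_prime_ideal:
  fixes M :: "'r::ring_1 set"
  assumes "0 \<notin> M" and M_mult: "\<And>x y. x \<in> M \<Longrightarrow> y \<in> M \<Longrightarrow> x * y \<in> M"
  obtains P where "normal_prime_ideal P" "P \<inter> M = {}"
proof -
  let ?A = "{I. ring_ideal I \<and> I \<inter> M = {}}"
  have "\<exists>P\<in>?A. \<forall>X\<in>?A. P \<subseteq> X \<longrightarrow> X = P"
  proof (rule subset_Zorn_nonempty)
    have "{0} \<in> ?A" using assms(1) by (simp add: ring_ideal_def)
    then show "?A \<noteq> {}" by blast
  next
    fix C assume C: "C \<noteq> {}" "subset.chain ?A C"
    then have CA: "C \<subseteq> ?A" and tot: "\<And>X Y. X \<in> C \<Longrightarrow> Y \<in> C \<Longrightarrow> X \<subseteq> Y \<or> Y \<subseteq> X"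
      by (auto simp: subset_chain_def)
    have "ring_ideal (\<Union>C)"
      unfolding ring_ideal_def
    proof (intro conjI ballI allI)
      show "0 \<in> \<Union>C" using C(1) CA by (auto dest: ring_ideal_zero)
    next
      fix x y assume "x \<in> \<Union>C" "y \<in> \<Union>C"
      then obtain X Y where XY: "X \<in> C" "x \<in> X" "Y \<in> C" "y \<in> Y" by blast
      with tot consider "x \<in> Y" | "y \<in> X" by blast
      then show "x + y \<in> \<Union>C"
        by cases (use XY CA in \<open>blast intro: ring_ideal_add\<close>)+
    next
      fix x l r assume "x \<in> \<Union>C"
      then show "l * x * r \<in> \<Union>C" using CA by (blast intro: ring_ideal_mult)
    qed
    then show "\<Union>C \<in> ?A" using CA by blast
  qed
  then obtain P where P: "ring_ideal P" "P \<inter> M = {}"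
    and max: "\<And>X. ring_ideal X \<Longrightarrow> X \<inter> M = {} \<Longrightarrow> P \<subseteq> X \<Longrightarrow> X = P"
    by auto
  have meet: "\<exists>m\<in>M. m \<in> two_sided_ideal (insert u P)" if "u \<notin> P" for u
  proof (rule ccontr)
    assume "\<not> ?thesis"
    then have "two_sided_ideal (insert u P) = P"
      by (intro max ring_ideal_two_sided_ideal) (auto intro: two_sided_ideal.base)
    then show False using that two_sided_ideal.base[of u "insert u P"] by auto
  qed
  have "u \<in> P \<or> v \<in> P" if u: "normal_element u" and uv: "u * v \<in> P" for u v
  proof (rule ccontr)
    assume "\<not> ?thesis"
    then obtain m n where mn: "m \<in> M" "m \<in> two_sided_ideal (insert u P)"
      "n \<in> M" "n \<in> two_sided_ideal (insert v P)"
      using meet by blast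
    have "u * r * v \<in> P" for r
    proof -
      from u obtain s where "u * r = s * u" unfolding normal_element_def by blast
      then show ?thesis using ring_ideal_left[OF P(1) uv, of s] by (simp add: mult.assoc)
    qed
    then have "m * n \<in> P"
      by (rule two_sided_ideal_normal[OF P(1) mn(2,4)])
    with M_mult mn P(2) show False by blast
  qed
  with that P show ?thesis by (auto simp: normal_prime_ideal_def)
qed

section \<open>Ring homomorphisms out of the Milnor--Witt K-ring\<close>

definition is_ring_hom :: "('r::ring_1 \<Rightarrow> 's::ring_1) \<Rightarrow> bool" where
  "is_ring_hom f \<longleftrightarrow> f 1 = 1 \<and> (\<forall>x y. f (x + y) = f x + f y) \<and> (\<forall>x y. f (x * y) = f x * f y)"

lemma is_ring_hom_simps:
  assumes "is_ring_hom f"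
  shows "f 1 = 1" "f (x + y) = f x + f y" "f (x * y) = f x * f y" "f 0 = 0" "f (- x) = - f x"
    "f (x - y) = f x - f y" "f (x ^ n) = f x ^ n" "f (of_nat n) = of_nat n" "f (of_int k) = of_int k"
    "f 2 = 2"
proof -
  show a: "f 1 = 1" "f (x + y) = f x + f y" "f (x * y) = f x * f y" for x y
    using assms by (auto simp: is_ring_hom_def)
  show z: "f 0 = 0" using a(2)[of 0 0] by simp
  show m: "f (- x) = - f x" for x using a(2)[of x "- x"] z by (simp add: eq_neg_iff_add_eq_0 add.commute)
  show d: "f (x - y) = f x - f y" using a(2)[of x "- y"] m by simp
  show "f (x ^ n) = f x ^ n" by (induction n) (simp_all add: a)
  show n: "f (of_nat n) = of_nat n" for n by (induction n) (simp_all add: a z)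
  show "f (of_int k) = of_int k"
    by (cases k rule: int_cases2) (simp_all add: n m)
  show "f 2 = 2" using n[of 2] by simp
qed

section \<open>Evaluation homomorphisms of the free ring\<close>

definition free_ring_eval :: "('g \<Rightarrow> 's::ring_1) \<Rightarrow> 'g free_ring \<Rightarrow> 's" where
  "free_ring_eval f p =
    (\<Sum>w\<in>Poly_Mapping.keys p. of_int (Poly_Mapping.lookup p w) * prod_list (map f (letters w)))"

lemma free_ring_eval_superset:
  assumes "finite A" "Poly_Mapping.keys p \<subseteq> A"
  shows "free_ring_eval f p =
    (\<Sum>w\<in>A. of_int (Poly_Mapping.lookup p w) * prod_list (map f (letters w)))"
  unfolding free_ring_eval_def
  by (rule sum.mono_neutral_left) (use assms in \<open>auto simp: in_keys_iff\<close>)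

lemma free_ring_eval_zero: "free_ring_eval f 0 = 0"
  by (simp add: free_ring_eval_def)

lemma free_ring_eval_diff: "free_ring_eval f (p - q) = free_ring_eval f p - free_ring_eval f q"
proof -
  let ?A = "Poly_Mapping.keys p \<union> Poly_Mapping.keys q"
  have "Poly_Mapping.keys (p - q) \<subseteq> ?A" by (auto simp: in_keys_iff lookup_minus)
  then show ?thesis
    by (simp add: free_ring_eval_superset[where A = ?A] lookup_minus left_diff_distrib
        sum_subtractf)
qed

lemma free_ring_eval_uminus: "free_ring_eval f (- p) = - free_ring_eval f p"
  using free_ring_eval_diff[of f 0 p] by (simp add: free_ring_eval_zero)

lemma free_ring_eval_add: "free_ring_eval f (p + q) = free_ring_eval f p + free_ring_eval f q"
  using free_ring_eval_diff[of f p "- q"] by (simp add: free_ring_eval_uminus)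

lemma free_ring_eval_frag_of: "free_ring_eval f (frag_of w) = prod_list (map f (letters w))"
  by (simp add: free_ring_eval_def)

lemma frag_of_plus: "frag_of (u + v :: 'g gen_word) = frag_of u * frag_of v"
  by (simp add: mult_single)

text \<open>Additively the free ring is the free abelian group on the words, and evaluation turns
  concatenation of words into products. \<open>frag_induction\<close> extends this first to q, then
  to p.\<close>

lemma free_ring_eval_mult: "free_ring_eval f (p * q) = free_ring_eval f p * free_ring_eval f q"
proof -
  have words: "free_ring_eval f (frag_of u * frag_of v) =
      free_ring_eval f (frag_of u) * free_ring_eval f (frag_of v)" for u v
    unfolding frag_of_plus[symmetric] free_ring_eval_frag_of by (simp add: plus_gen_word_def)
  have left: "free_ring_eval f (frag_of u * q) = free_ring_eval f (frag_of u) * free_ring_eval f q" for u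
    using subset_UNIV[of "Poly_Mapping.keys q"]
    by (induction q rule: frag_induction)
      (simp_all add: words free_ring_eval_zero free_ring_eval_diff right_diff_distrib del: mult_single)
  show ?thesis
    using subset_UNIV[of "Poly_Mapping.keys p"]
    by (induction p rule: frag_induction)
      (simp_all add: left free_ring_eval_zero free_ring_eval_diff left_diff_distrib)
qed

lemma one_eq_frag_of: "(1 :: 'g free_ring) = frag_of 0"
  by simp

lemma is_ring_hom_free_ring_eval: "is_ring_hom (free_ring_eval f)"
  by (simp add: is_ring_hom_def free_ring_eval_add free_ring_eval_mult one_eq_frag_of
      free_ring_eval_frag_of zero_gen_word_def del: single_one)

lemma free_ring_eval_generator: "free_ring_eval f (generator g) = f g"
  by (simp add: generator_def free_ring_eval_frag_of)

section \<open>Relations, homomorphisms and induction for the quotient ring\<close>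

definition symb :: "'a::field \<Rightarrow> 'a milnor_witt" where
  "symb a = abs_milnor_witt (mw_symbol a)"

definition eta :: "'a::field milnor_witt" where
  "eta = abs_milnor_witt mw_eta"

lemma abs_milnor_witt_hom: "is_ring_hom (abs_milnor_witt :: _ \<Rightarrow> 'a::field milnor_witt)"
  by (auto simp: is_ring_hom_def one_milnor_witt.abs_eq plus_milnor_witt.abs_eq
      times_milnor_witt.abs_eq)

lemma abs_milnor_witt_eq_iff: "abs_milnor_witt x = abs_milnor_witt y \<longleftrightarrow> mw_cong x y"
  using Quotient3_rel[OF Quotient3_milnor_witt] by (simp add: mw_cong_def two_sided_ideal.zero)

lemma relation_abs_milnor_witt: "x \<in> mw_relations \<Longrightarrow> abs_milnor_witt x = 0"
  unfolding zero_milnor_witt.abs_eq abs_milnor_witt_eq_iff mw_cong_def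
  by (simp add: two_sided_ideal.base)

lemmas abs_simps = is_ring_hom_simps[OF abs_milnor_witt_hom]

lemma steinberg: "a \<noteq> 0 \<Longrightarrow> a \<noteq> 1 \<Longrightarrow> symb a * symb (1 - a) = 0"
  using relation_abs_milnor_witt[OF mw_relations.steinberg] by (simp add: symb_def abs_simps)

lemma symb_mult:
  "a \<noteq> 0 \<Longrightarrow> b \<noteq> 0 \<Longrightarrow> symb (a * b) = symb a + symb b + eta * symb a * symb b"
  using relation_abs_milnor_witt[OF mw_relations.twisted_log, of a b]
  by (simp add: symb_def eta_def abs_simps)

lemma eta_symb_commute: "a \<noteq> 0 \<Longrightarrow> symb a * eta = eta * symb a"
  using relation_abs_milnor_witt[OF mw_relations.eta_central, of a]
  by (simp add: symb_def eta_def abs_simps)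

lemma eta_hyperbolic: "eta * (eta * symb (- 1) + 2) = 0"
  using relation_abs_milnor_witt[OF mw_relations.eta_hyperbolic] 
  by (simp add: symb_def eta_def abs_simps)

text \<open>Evaluation in the free ring kills the ideal of relations, hence is constant on
  congruence classes. This universal property later yields the signatures, the rank map and the map
  to Z/2.\<close>

lemma milnor_witt_hom_exists:
  fixes g :: "'a::field \<Rightarrow> 's::ring_1" and e :: 's
  assumes "\<And>a. a \<noteq> 0 \<Longrightarrow> a \<noteq> 1 \<Longrightarrow> g a * g (1 - a) = 0"
    and "\<And>a b. a \<noteq> 0 \<Longrightarrow> b \<noteq> 0 \<Longrightarrow> g (a * b) = g a + g b + e * g a * g b"
    and "\<And>a. a \<noteq> 0 \<Longrightarrow> e * g a = g a * e"
    and "e * (e * g (- 1) + 2) = 0"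
  obtains \<phi> :: "'a milnor_witt \<Rightarrow> 's"
  where "is_ring_hom \<phi>" "\<And>a. a \<noteq> 0 \<Longrightarrow> \<phi> (symb a) = g a" "\<phi> eta = e"
proof -
  define f where "f = case_mw_generator (\<lambda>u. g (Rep_nonzero u)) e"
  note hom = is_ring_hom_simps[OF is_ring_hom_free_ring_eval[of f]]
  have s: "free_ring_eval f (mw_symbol a) = g a" if "a \<noteq> 0" for a
    using that by (simp add: mw_symbol_def free_ring_eval_generator f_def Abs_nonzero_inverse)
  have t: "free_ring_eval f mw_eta = e"
    by (simp add: mw_eta_def free_ring_eval_generator f_def)
  have rel: "free_ring_eval f x = 0" if "x \<in> mw_relations" for x
    using that
  proof cases
    case (steinberg a)
    then show ?thesis using assms(1)[of a] s[of a] s[of "1 - a"] by (simp add: hom)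
  next
    case eta_hyperbolic
    then show ?thesis using assms(4) s[of "- 1"]  by (simp add: hom t)
  qed (use assms(2,3) in \<open>simp_all add: hom s t\<close>)
  have "free_ring_eval f x = 0" if "x \<in> two_sided_ideal mw_relations" for x
    using that by induction (simp_all add: hom rel)
  then have cong: "free_ring_eval f x = free_ring_eval f y" if "mw_cong x y" for x y
    using that hom(6)[of x y] by (simp add: mw_cong_def)
  define \<phi> where "\<phi> x = free_ring_eval f (rep_milnor_witt x)" for x
  have abs: "\<phi> (abs_milnor_witt p) = free_ring_eval f p" for p
    unfolding \<phi>_def
    by (rule cong) (metis Quotient3_abs_rep[OF Quotient3_milnor_witt] abs_milnor_witt_eq_iff)
  have "is_ring_hom \<phi>"
    unfolding is_ring_hom_def
  proof (intro conjI allI)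
    show "\<phi> 1 = 1" by (simp add: one_milnor_witt.abs_eq abs hom)
    fix x y :: "'a milnor_witt"
    obtain p q where "x = abs_milnor_witt p" "y = abs_milnor_witt q"
      by (metis Quotient3_abs_rep[OF Quotient3_milnor_witt])
    then show "\<phi> (x + y) = \<phi> x + \<phi> y" "\<phi> (x * y) = \<phi> x * \<phi> y"
      by (simp_all add: plus_milnor_witt.abs_eq times_milnor_witt.abs_eq abs hom)
  qed
  then show ?thesis
    by (rule that) (simp_all add: symb_def eta_def abs s t)
qed

text \<open>A representative of x is an integer combination of words of degree n, and each word is
  built from 1 by left multiplication with generators. Closure under differences covers all integer
  combinations.\<close>

lemma KMW_induct [consumes 1, case_names zero one diff sym eta]:
  assumes "x \<in> KMW n"
    and zero: "\<And>n. Q n 0" and one: "Q 0 1"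
    and diff: "\<And>n x y. Q n x \<Longrightarrow> Q n y \<Longrightarrow> Q n (x - y)"
    and sym: "\<And>n a x. a \<noteq> 0 \<Longrightarrow> Q n x \<Longrightarrow> Q (n + 1) (symb a * x)"
    and eta: "\<And>n x. Q n x \<Longrightarrow> Q (n - 1) (eta * x)"
  shows "Q n (x :: 'a::field milnor_witt)"
proof -
  have word: "Q (mw_word_degree (Gen_Word l)) (abs_milnor_witt (frag_of (Gen_Word l)))"
    for l :: "'a nonzero mw_generator list"
  proof (induction l)
    case Nil
    have "frag_of (Gen_Word []) = (1 :: 'a nonzero mw_generator free_ring)"
      by (simp add: zero_gen_word_def[symmetric])
    then show ?case using one by (simp add: mw_word_degree_def abs_simps)
  next
    case (Cons g l)
    have "Gen_Word (g # l) = Gen_Word [g] + Gen_Word l"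
      by (simp add: plus_gen_word_def)
    then have *: "abs_milnor_witt (frag_of (Gen_Word (g # l))) =
        abs_milnor_witt (generator g) * abs_milnor_witt (frag_of (Gen_Word l))"
      by (simp only: frag_of_plus abs_simps generator_def)
    show ?case
    proof (cases g)
      case (Symbol u)
      have "Rep_nonzero u \<noteq> 0" "abs_milnor_witt (generator g) = symb (Rep_nonzero u)"
        using Rep_nonzero[of u] by (auto simp: Symbol symb_def mw_symbol_def Rep_nonzero_inverse)
      with sym[OF _ Cons, of "Rep_nonzero u"] show ?thesis
        unfolding * by (simp add: Symbol mw_word_degree_def add.commute)
    next
      case Eta
      with eta[OF Cons] show ?thesis
        unfolding * by (simp add: mw_word_degree_def eta_def mw_eta_def)
    qed
  qed
  from assms(1) obtain p where p: "x = abs_milnor_witt p"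
    "Poly_Mapping.keys p \<subseteq> {w. mw_word_degree w = n}"
    by (auto simp: KMW_def)
  from p(2) have "Q n (abs_milnor_witt p)"
  proof (induction p rule: frag_induction)
    case (one w)
    then show ?case using word[of "letters w"] by simp
  qed (simp_all add: abs_simps zero diff)
  with p(1) show ?thesis by simp
qed

lemma milnor_witt_induct [case_names zero one diff sym eta]:
  fixes x :: "'a::field milnor_witt"
  assumes zero: "Q 0" and one: "Q 1"
    and diff: "\<And>x y. Q x \<Longrightarrow> Q y \<Longrightarrow> Q (x - y)"
    and sym: "\<And>a x. a \<noteq> 0 \<Longrightarrow> Q x \<Longrightarrow> Q (symb a * x)"
    and eta: "\<And>x. Q x \<Longrightarrow> Q (eta * x)"
  shows "Q x"
proof -
  obtain p where p: "x = abs_milnor_witt p"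
    by (metis Quotient3_abs_rep[OF Quotient3_milnor_witt])
  have word: "Q (abs_milnor_witt (frag_of w))" for w
  proof -
    have "abs_milnor_witt (frag_of w) \<in> KMW (mw_word_degree w)"
      by (auto simp: KMW_def)
    then show ?thesis
      by (induction rule: KMW_induct) (use assms in auto)
  qed
  from subset_UNIV have "Q (abs_milnor_witt p)"
    by (induction p rule: frag_induction) (simp_all add: abs_simps zero diff word)
  with p show ?thesis by simp
qed

section \<open>Identities in the Milnor--Witt K-ring\<close>

text \<open>\<open>ang a\<close> is $\langle a\rangle$ and \<open>hyp\<close> is the hyperbolic element $h$.\<close>

definition ang :: "'a::field \<Rightarrow> 'a milnor_witt" where
  "ang a = 1 + eta * symb a"

definition hyp :: "'a::field milnor_witt" where
  "hyp = 2 + eta * symb (- 1)"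

lemma hyp_eq_ang: "hyp = 1 + ang (- 1)"
  by (simp add: hyp_def ang_def)

lemma symb_mult_ang: "a \<noteq> 0 \<Longrightarrow> b \<noteq> 0 \<Longrightarrow> symb (a * b) = symb a + ang a * symb b"
  by (simp add: symb_mult ang_def distrib_right add.assoc)

text \<open>Expand [ab] = [ba] both ways, multiplication in F being commutative.\<close>

lemma eta_symb_symb:
  assumes "a \<noteq> 0" "b \<noteq> 0"
  shows "eta * symb a * symb b = eta * symb b * symb a"
  using symb_mult[OF assms] symb_mult[OF assms(2,1)] by (simp add: mult.commute[of b] add.commute)

lemma ang_symb_commute: "a \<noteq> 0 \<Longrightarrow> b \<noteq> 0 \<Longrightarrow> symb b * ang a = ang a * symb b"
  using eta_symb_symb[of a b] eta_symb_commute[of b]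
  by (simp add: ang_def algebra_simps) (metis mult.assoc)

lemma eta_ang_commute: "a \<noteq> 0 \<Longrightarrow> eta * ang a = ang a * eta"
  using eta_symb_commute[of a] by (simp add: ang_def algebra_simps)

lemma ang_mult: "a \<noteq> 0 \<Longrightarrow> b \<noteq> 0 \<Longrightarrow> ang (a * b) = ang a * ang b"
proof -
  assume ab: "a \<noteq> 0" "b \<noteq> 0"
  have "ang a * ang b = ang a + ang a * eta * symb b"
    by (simp add: ang_def[of b] distrib_left mult.assoc)
  also have "\<dots> = ang a + eta * (ang a * symb b)"
    by (simp only: eta_ang_commute[OF ab(1), symmetric] mult.assoc)
  also have "\<dots> = ang (a * b)"
    by (simp add: ang_def[of "a * b"] symb_mult_ang ab distrib_left) (simp add: ang_def)
  finally show ?thesis ..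
qed

lemma eta_hyp: "eta * hyp = 0"
  using eta_hyperbolic by (simp add: hyp_def add.commute)

text \<open>Since <-1><1> = <-1>, we get h<1> = <1> + <-1>, and \<eta> h = 0 then gives
  \<eta>(\<eta>[1]) = 0. The relation for [1 * 1] reads [1] + \<eta>[1][1] = 0; multiplied by \<eta>
  it gives \<eta>[1] = 0, and then [1] = 0.\<close>

lemma eta_symb_one: "eta * symb 1 = (0 :: 'a::field milnor_witt)"
  and symb_one: "symb 1 = (0 :: 'a milnor_witt)"
proof -
  have "hyp * ang 1 = ang 1 + (ang (- 1) :: 'a milnor_witt)"
    using ang_mult[of "- 1" "1 :: 'a"] by (simp add: hyp_eq_ang distrib_right)
  moreover have "eta * (hyp * ang 1) = (0 :: 'a milnor_witt)"
    by (simp add: eta_hyp flip: mult.assoc)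
  ultimately have "eta * (ang 1 + ang (- 1) - hyp) = (0 :: 'a milnor_witt)"
    by (simp add: right_diff_distrib eta_hyp)
  then have eta2: "eta * (eta * symb 1) = (0 :: 'a milnor_witt)"
    by (simp add: hyp_eq_ang ang_def)
  have 1: "symb 1 + eta * symb 1 * symb 1 = (0 :: 'a milnor_witt)"
    using symb_mult[of 1 "1 :: 'a"] by simp
  then have "eta * symb 1 + eta * (eta * symb 1) * symb 1 = (0 :: 'a milnor_witt)"
    by (metis distrib_left mult.assoc mult_zero_right)
  then show e: "eta * symb 1 = (0 :: 'a milnor_witt)" using eta2 by simp
  show "symb 1 = (0 :: 'a milnor_witt)" using 1 by (simp add: e)
qed

lemma ang_one: "ang 1 = 1"
  by (simp add: ang_def eta_symb_one)

lemma hyp_symb_commute: "a \<noteq> 0 \<Longrightarrow> symb a * hyp = hyp * symb a"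
  using ang_symb_commute[of "- 1" a] by (simp add: hyp_eq_ang distrib_left distrib_right)

lemma symb_inverse: "a \<noteq> 0 \<Longrightarrow> symb a = - ang a * symb (inverse a)"
  using symb_mult_ang[of a "inverse a"] by (simp add: symb_one eq_neg_iff_add_eq_0)

lemma symb_divide: "b \<noteq> 0 \<Longrightarrow> c \<noteq> 0 \<Longrightarrow> symb (b / c) = symb b - ang (b / c) * symb c"
  using symb_mult_ang[of "b / c" c] by simp

text \<open>For a \<noteq> 1 write -a = (1 - a) / (1 - 1/a). The Steinberg relation for a removes
  the numerator; after [a] = -<a>[1/a], the one for 1/a removes the denominator.\<close>

lemma symb_mult_neg: "a \<noteq> 0 \<Longrightarrow> symb a * symb (- a) = 0"
proof (cases "a = 1")
  case False
  assume a: "a \<noteq> 0"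
  let ?b = "inverse a"
  have nz: "1 - a \<noteq> 0" "1 - ?b \<noteq> 0" using False by auto
  have quot: "- a = (1 - a) / (1 - ?b)" using a nz by (simp add: field_simps)
  have "symb (- a) = symb (1 - a) - ang (- a) * symb (1 - ?b)"
    using symb_divide[OF nz] quot by simp
  then have "symb a * symb (- a) = - (symb a * ang (- a) * symb (1 - ?b))"
    using steinberg[of a] a False by (simp add: right_diff_distrib mult.assoc)
  also have "\<dots> = - (ang (- a) * symb a * symb (1 - ?b))"
    using ang_symb_commute[of "- a" a] a by simp
  also have "\<dots> = ang (- a) * ang a * (symb ?b * symb (1 - ?b))"
    using symb_inverse[OF a] by (simp add: mult.assoc)
  also have "\<dots> = 0" using steinberg[of ?b] a False by simp
  finally show ?thesis .
qed (simp add: symb_one)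

text \<open>This is the relation for [(-1)(-1)] = [1] = 0.\<close>

lemma hyp_symb_neg_one: "hyp * symb (- 1) = 0"
  using symb_mult[of "- 1" "- 1"] by (simp add: symb_one hyp_def distrib_right mult_2 add.assoc)

lemma ang_neg_one_mult: "ang (- 1) * x = hyp * x - x"
  by (simp add: hyp_eq_ang distrib_right)

text \<open>Insert [-a] = [-1] + <-1>[a] into [a][-a] = 0 and multiply by <-1>, whose square is 1.
  As h kills [a][-1], the factor <-1> acts on it as -1.\<close>

lemma symb_square: "a \<noteq> 0 \<Longrightarrow> symb a * symb a = symb a * symb (- 1)"
proof -
  assume a: "a \<noteq> 0"
  have hr: "hyp * (symb a * symb (- 1)) = 0"
    using hyp_symb_commute[OF a] hyp_symb_neg_one by (metis mult.assoc mult_zero_right)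
  have inv: "ang (- 1) * ang (- 1) = (1 :: 'a milnor_witt)"
    using ang_mult[of "- 1" "- 1 :: 'a"] by (simp add: ang_one)
  have "symb (- a) = symb (- 1) + ang (- 1) * symb a"
    using symb_mult_ang[of "- 1" a] a by simp
  then have "symb a * symb (- 1) + symb a * ang (- 1) * symb a = 0"
    using symb_mult_neg[OF a] by (simp add: distrib_left mult.assoc)
  then have "symb a * symb (- 1) + ang (- 1) * (symb a * symb a) = 0"
    using ang_symb_commute[of "- 1" a] a by (simp add: mult.assoc)
  then have "ang (- 1) * (symb a * symb (- 1)) + ang (- 1) * ang (- 1) * (symb a * symb a) = 0"
    by (metis distrib_left mult.assoc mult_zero_right)
  then have "ang (- 1) * (symb a * symb (- 1)) + symb a * symb a = 0"
    by (simp only: inv mult_1_left)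
  then show ?thesis by (simp add: ang_neg_one_mult hr)
qed

lemma symb_of_square: "a \<noteq> 0 \<Longrightarrow> symb (a * a) = hyp * symb a"
  using symb_mult[of a a] symb_square[of a] eta_symb_symb[of a "- 1"]
  by (simp add: hyp_def distrib_right mult_2 mult.assoc)

lemma ang_square: "a \<noteq> 0 \<Longrightarrow> ang a * ang a = 1"
  using ang_mult[of a a] by (simp add: ang_def[of "a * a"] symb_of_square eta_hyp flip: mult.assoc)

text \<open>Expand [ab][-ab] = 0 by [ab] = [a] + <a>[b] and [-ab] = [-a] + <-a>[b]. The term [a][-a]
  vanishes and [b][b] becomes [b][-1]; what is left, divided by <a>, relates [a][b] and
  [b][a].\<close>

lemma symb_anticommute:
  assumes "a \<noteq> 0" "b \<noteq> 0"
  shows "symb a * symb b = - ang (- 1) * symb b * symb a"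
proof -
  let ?r = "symb (- 1) :: 'a milnor_witt"
  have nz: "- a \<noteq> 0" "a * b \<noteq> 0" using assms by auto
  have e1: "ang (- a) = ang a * ang (- 1)" using ang_mult[of a "- 1"] assms by simp
  have "hyp * (symb b * ?r) = 0"
    using hyp_symb_commute[OF assms(2)] hyp_symb_neg_one by (metis mult.assoc mult_zero_right)
  then have sq: "ang (- 1) * (symb b * symb b) = - (symb b * ?r)"
    by (simp add: symb_square[OF assms(2)] ang_neg_one_mult)
  have na: "symb (- a) = ?r + ang (- 1) * symb a" using symb_mult_ang[of "- 1" a] assms by simp
  have "(symb a + ang a * symb b) * (symb (- a) + ang (- a) * symb b) = 0"
    using symb_mult_neg[OF nz(2)] symb_mult_ang[of a b] symb_mult_ang[of "- a" b] assms by simp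
  then have "symb a * ang (- a) * symb b + ang a * symb b * symb (- a) +
      ang a * symb b * ang (- a) * symb b = 0"
    using symb_mult_neg[OF assms(1)] by (simp add: algebra_simps)
  moreover have "symb a * ang (- a) * symb b = ang a * (ang (- 1) * (symb a * symb b))"
    using ang_symb_commute[of "- a" a] assms by (simp add: e1 mult.assoc)
  moreover have "ang a * symb b * symb (- a) =
      ang a * (symb b * ?r + ang (- 1) * (symb b * symb a))"
    using ang_symb_commute[of "- 1" b] assms
    by (simp add: na distrib_left mult.assoc) (metis mult.assoc)
  moreover have "ang a * symb b * ang (- a) * symb b = ang a * (ang a * - (symb b * ?r))"
  proof -
    have "ang a * symb b * ang (- a) * symb b = ang a * (symb b * ang (- a)) * symb b"
      by (simp add: mult.assoc)
    also have "\<dots> = ang a * (ang (- a) * symb b) * symb b"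
      using ang_symb_commute[of "- a" b] assms by simp
    also have "\<dots> = ang a * (ang a * (ang (- 1) * (symb b * symb b)))"
      by (simp add: e1 mult.assoc)
    finally show ?thesis by (simp add: sq)
  qed
  ultimately have "ang a * (ang (- 1) * (symb a * symb b) + symb b * ?r +
      ang (- 1) * (symb b * symb a) - ang a * (symb b * ?r)) = 0"
    by (simp add: algebra_simps)
  \<comment> \<open>The common factor <a> is cancelled by a second one, since <a><a> = 1.\<close>
  then have "ang a * ang a * (ang (- 1) * (symb a * symb b) + symb b * ?r +
      ang (- 1) * (symb b * symb a) - ang a * (symb b * ?r)) = 0"
    by (simp only: mult.assoc mult_zero_right)
  then have "ang (- 1) * (symb a * symb b) + symb b * ?r +
      ang (- 1) * (symb b * symb a) - (symb b * ?r + eta * symb a * (symb b * ?r)) = 0"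
    by (simp only: ang_square[OF assms(1)] mult_1_left) (simp add: ang_def[of a] distrib_right)
  moreover have "w + y + z - (y + v) = w + z - v" for v w y z :: "'a milnor_witt"
    by simp
  ultimately have main: "ang (- 1) * (symb a * symb b) + ang (- 1) * (symb b * symb a) =
      eta * symb a * symb b * ?r"
    by (simp add: mult.assoc)
  \<comment> \<open>In the presence of \<eta> symbols commute, so [-1] moves to the front, where
    \<eta>[-1] = <-1> - 1.\<close>
  have "eta * symb a * symb b * ?r = symb a * (eta * symb b * ?r)"
    by (simp only: eta_symb_commute[OF assms(1), symmetric] mult.assoc)
  also have "eta * symb b * ?r = eta * ?r * symb b"
    by (rule eta_symb_symb) (use assms in auto)
  also have "symb a * (eta * ?r * symb b) = eta * symb a * ?r * symb b"
    by (simp only: eta_symb_commute[OF assms(1), symmetric] mult.assoc)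
  also have "eta * symb a * ?r = eta * ?r * symb a"
    by (rule eta_symb_symb) (use assms in auto)
  also have "eta * ?r * symb a * symb b = eta * ?r * (symb a * symb b)"
    by (rule mult.assoc)
  also have "\<dots> = ang (- 1) * (symb a * symb b) - symb a * symb b"
    by (simp add: ang_def distrib_right)
  finally show ?thesis using main by (simp add: mult.assoc eq_neg_iff_add_eq_0 add.commute)
qed

section \<open>Central and normal elements\<close>

lemma eta_commute: "x * eta = eta * x"
proof (induction x rule: milnor_witt_induct)
  case (sym a x)
  then show ?case using eta_symb_commute[of a] by (metis mult.assoc)
qed (simp_all add: algebra_simps)

lemma hyp_commute: "x * hyp = hyp * x"
proof (induction x rule: milnor_witt_induct)
  case (sym a x)
  then show ?case using hyp_symb_commute[of a] by (metis mult.assoc)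
next
  case (eta x)
  then show ?case using eta_commute[of hyp] by (metis mult.assoc)
qed (simp_all add: algebra_simps)

lemma eta_normal: "normal_element eta"
  using eta_commute by (metis normal_element_def)

text \<open>Moving [a] to the right across a generator [b] costs only the left factor -<-1>, and
  across \<eta> nothing.\<close>

lemma symb_normal:
  assumes "a \<noteq> 0"
  shows "normal_element (symb a)"
  unfolding normal_element_def
proof
  fix x
  show "\<exists>s. symb a * x = s * symb a"
  proof (induction x rule: milnor_witt_induct)
    case zero
    show ?case by (rule exI[of _ 0]) simp
  next
    case one
    show ?case by (rule exI[of _ 1]) simp
  next
    case (diff x y)
    then obtain s t where "symb a * x = s * symb a" "symb a * y = t * symb a" by blast
    then show ?case by (intro exI[of _ "s - t"]) (simp add: algebra_simps)
  next
    case (sym b x)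
    then obtain s where "symb a * x = s * symb a" by blast
    then have "symb a * (symb b * x) = - ang (- 1) * symb b * s * symb a"
      using symb_anticommute[OF assms sym(1)] by (simp flip: mult.assoc) (simp add: mult.assoc)
    then show ?case ..
  next
    case (eta x)
    then obtain s where "symb a * x = s * symb a" by blast
    then have "symb a * (eta * x) = eta * s * symb a"
      using eta_symb_commute[OF assms] by (metis mult.assoc)
    then show ?case ..
  qed
qed

section \<open>Orderings\<close>

text \<open>The strictly positive elements of a field ordering. As 0 is excluded, closure under
  addition keeps a and -a from both lying in S.\<close>

definition positive_cone :: "'a::field set \<Rightarrow> bool" where
  "positive_cone S \<longleftrightarrow> 0 \<notin> S \<and> (\<forall>a\<in>S. \<forall>b\<in>S. a + b \<in> S \<and> a * b \<in> S) \<and>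
    (\<forall>a. a \<noteq> 0 \<longrightarrow> a \<in> S \<or> - a \<in> S)"

lemma positive_coneD:
  assumes "positive_cone S"
  shows "a \<in> S \<Longrightarrow> a \<noteq> 0" "a \<in> S \<Longrightarrow> b \<in> S \<Longrightarrow> a + b \<in> S" "a \<in> S \<Longrightarrow> b \<in> S \<Longrightarrow> a * b \<in> S"
    "a \<noteq> 0 \<Longrightarrow> a \<in> S \<or> - a \<in> S"
  using assms by (auto simp: positive_cone_def)

lemma positive_cone_uminus:
  assumes "positive_cone S" "a \<noteq> 0"
  shows "- a \<in> S \<longleftrightarrow> a \<notin> S"
  using positive_coneD[OF assms(1)] assms(2) by (metis add.right_inverse)

lemma positive_cone_mult_iff:
  assumes "positive_cone S" "a \<noteq> 0" "b \<noteq> 0"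
  shows "a * b \<in> S \<longleftrightarrow> (a \<in> S \<longleftrightarrow> b \<in> S)"
  using positive_coneD(3)[OF assms(1), of a b] positive_coneD(3)[OF assms(1), of "- a" b]
    positive_coneD(3)[OF assms(1), of a "- b"] positive_coneD(3)[OF assms(1), of "- a" "- b"]
    positive_cone_uminus[OF assms(1)] assms(2,3)
  by auto

lemma positive_cone_one: "positive_cone S \<Longrightarrow> 1 \<in> S"
  using positive_cone_mult_iff[of S 1 1] by simp

lemma formally_real_iff: "formally_real TYPE('a::field) \<longleftrightarrow> (\<exists>S :: 'a set. positive_cone S)"
proof
  assume "formally_real TYPE('a)"
  then obtain le lt :: "'a \<Rightarrow> 'a \<Rightarrow> bool" where lin: "class.linorder le lt"
    and add: "\<And>a b c. le a b \<Longrightarrow> le (c + a) (c + b)"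
    and mult: "\<And>a b. le 0 a \<Longrightarrow> le 0 b \<Longrightarrow> le 0 (a * b)"
    unfolding formally_real_def by blast
  interpret linorder le lt by (rule lin)
  have neg: "le 0 (- a)" if "le a 0" for a using add[OF that, of "- a"] by simp
  have "positive_cone {a. le 0 a \<and> a \<noteq> 0}"
    unfolding positive_cone_def
  proof (intro conjI ballI allI impI)
    fix a b assume "a \<in> {a. le 0 a \<and> a \<noteq> 0}" "b \<in> {a. le 0 a \<and> a \<noteq> 0}"
    then have ab: "le 0 a" "le 0 b" "a \<noteq> 0" "b \<noteq> 0" by auto
    have "le a (a + b)" using add[OF ab(2), of a] by simp
    with ab have "le 0 (a + b)" "a + b \<noteq> 0" using order.trans order.antisym by metis+
    then show "a + b \<in> {a. le 0 a \<and> a \<noteq> 0}" by simp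
    show "a * b \<in> {a. le 0 a \<and> a \<noteq> 0}" using mult ab by simp
  next
    fix a :: 'a assume "a \<noteq> 0"
    then show "a \<in> {a. le 0 a \<and> a \<noteq> 0} \<or> - a \<in> {a. le 0 a \<and> a \<noteq> 0}"
      using linear[of 0 a] neg[of a] by auto
  qed simp
  then show "\<exists>S :: 'a set. positive_cone S" ..
next
  assume "\<exists>S :: 'a set. positive_cone S"
  then obtain S :: "'a set" where S: "positive_cone S" ..
  let ?lt = "\<lambda>a b. b - a \<in> S"
  have "class.linorder (\<lambda>a b. a = b \<or> ?lt a b) ?lt"
  proof
    fix x y z
    show "?lt x y \<longleftrightarrow> (x = y \<or> ?lt x y) \<and> \<not> (y = x \<or> ?lt y x)"
      using positive_cone_uminus[OF S, of "x - y"] positive_coneD(1)[OF S, of 0]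
      by (cases "x = y") auto
    show "x = y \<or> ?lt x y \<Longrightarrow> y = z \<or> ?lt y z \<Longrightarrow> x = z \<or> ?lt x z"
      using positive_coneD(2)[OF S, of "y - x" "z - y"] by auto
    show "x = y \<or> ?lt x y \<Longrightarrow> y = x \<or> ?lt y x \<Longrightarrow> x = y"
      using positive_cone_uminus[OF S, of "x - y"] by (cases "x = y") auto
    show "(x = y \<or> ?lt x y) \<or> (y = x \<or> ?lt y x)"
      using positive_coneD(4)[OF S, of "x - y"] by auto
  qed simp
  moreover have "0 = a * b \<or> ?lt 0 (a * b)" if "0 = a \<or> ?lt 0 a" "0 = b \<or> ?lt 0 b" for a b
    using that positive_coneD(3)[OF S, of a b] by auto
  ultimately show "formally_real TYPE('a)"
    unfolding formally_real_def
    by (intro exI[of _ "\<lambda>a b. a = b \<or> ?lt a b"] exI[of _ ?lt]) auto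
qed

text \<open>The values are chosen so that <a> = 1 + \<eta>[a] maps to the sign of a and h to 0. The
  Steinberg relation holds because a and 1 - a have sum 1 and so are not both negative.\<close>

lemma signature_hom_exists:
  fixes S :: "'a::field set"
  assumes "positive_cone S"
  obtains \<phi> :: "'a milnor_witt \<Rightarrow> int"
  where "is_ring_hom \<phi>" "\<And>a. a \<noteq> 0 \<Longrightarrow> \<phi> (symb a) = (if a \<in> S then 0 else - 2)" "\<phi> eta = 1"
proof (rule milnor_witt_hom_exists[of "\<lambda>a. if a \<in> S then 0 else - 2 :: int" 1])
  fix a :: 'a assume a: "a \<noteq> 0" "a \<noteq> 1"
  have "a \<in> S \<or> 1 - a \<in> S"
    using positive_cone_uminus[OF assms a(1)] positive_coneD(2)[OF assms, of 1 "- a"]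
      positive_cone_one[OF assms] by auto
  then show "(if a \<in> S then 0 else - 2) * (if 1 - a \<in> S then 0 else - 2) = (0 :: int)" by auto
next
  fix a b :: 'a assume "a \<noteq> 0" "b \<noteq> 0"
  from positive_cone_mult_iff[OF assms this]
  show "(if a * b \<in> S then 0 else - 2) = (if a \<in> S then 0 else - 2) + (if b \<in> S then 0 else - 2) +
    1 * (if a \<in> S then 0 else - 2) * (if b \<in> S then 0 else - 2 :: int)" by auto
next
  show "1 * (1 * (if (- 1 :: 'a) \<in> S then 0 else - 2) + 2) = (0 :: int)"
    using positive_cone_uminus[OF assms, of 1] positive_cone_one[OF assms] by simp
qed (use that in auto)

section \<open>Prime ideals and residues modulo them\<close>

text \<open>The dichotomy is primality applied to [a]([a] - [-1]) = 0. The main point is closure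
  under addition: if a and b are in the cone but a + b is not, then [a/(a+b)] and [b/(a+b)] are both
  congruent to [-1], and their Steinberg relation puts [-1][-1] into P.\<close>

lemma positive_cone_of_ideal:
  fixes P :: "'a::field milnor_witt set"
  assumes normal_prime: "normal_prime_ideal P"
    and neg_one: "symb (- 1) \<notin> P"
  shows "positive_cone {a. a \<noteq> 0 \<and> symb a \<in> P}"
    and "\<And>a. a \<noteq> 0 \<Longrightarrow> symb a \<in> P \<or> symb a - symb (- 1) \<in> P"
proof -
  let ?r = "symb (- 1) :: 'a milnor_witt"
  note P = normal_prime_ideal_ideal[OF normal_prime]
  note prime = normal_prime_idealD[OF normal_prime]
  note [simp] = ring_ideal_zero[OF P]
  show dich: "symb a \<in> P \<or> symb a - ?r \<in> P" if "a \<noteq> 0" for a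
    by (rule prime) (simp_all add: symb_normal that right_diff_distrib symb_square)
  have rr: "?r * ?r \<notin> P" using prime[OF symb_normal, of "- 1" ?r] neg_one by auto
  have mult: "symb (a * b) \<in> P" if "a \<noteq> 0" "symb a \<in> P" "b \<noteq> 0" "symb b \<in> P" for a b
    using that by (simp add: symb_mult ring_ideal_add[OF P] ring_ideal_left[OF P])
  have inv: "symb (inverse a) \<in> P" if "a \<noteq> 0" "symb a \<in> P" for a
    using symb_inverse[of "inverse a"] ring_ideal_left[OF P that(2), of "- ang (inverse a)"] that(1)
    by simp
  \<comment> \<open>By [-a] = [-1] + <-1>[a], having both [a] and [-a] in P would force [-1] into
    P.\<close>
  have neg: "symb a \<notin> P" if "a \<noteq> 0" "symb (- a) \<in> P" for a
  proof
    assume "symb a \<in> P"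
    then have "?r + ang (- 1) * symb a \<notin> P"
      using ring_ideal_cong[OF P, of "?r + ang (- 1) * symb a" ?r] neg_one ring_ideal_left[OF P]
      by simp
    then show False using that symb_mult_ang[of "- 1" a] by simp
  qed
  have add: "a + b \<noteq> 0 \<and> symb (a + b) \<in> P"
    if a: "a \<noteq> 0" "symb a \<in> P" and b: "b \<noteq> 0" "symb b \<in> P" for a b
  proof -
    have nz: "a + b \<noteq> 0"
      using neg[of a] a b by (metis add_eq_0_iff)
    moreover have "symb (a + b) \<in> P"
    proof (rule ccontr)
      assume notin: "symb (a + b) \<notin> P"
      have quot: "symb (c / (a + b)) - ?r \<in> P" if "c \<noteq> 0" "symb c \<in> P" for c
      proof -
        have "symb (c / (a + b)) \<notin> P"
        proof
          \<comment> \<open>Dividing by c, which is in the cone, and inverting would put [a + b]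
            into P.\<close>
          assume *: "symb (c / (a + b)) \<in> P"
          have "symb (c / (a + b) * inverse c) \<in> P"
            using mult[OF _ * _ inv[OF that]] that nz by simp
          also have "c / (a + b) * inverse c = inverse (a + b)"
            using that nz by (simp add: field_simps)
          finally show False using inv[of "inverse (a + b)"] notin nz by simp
        qed
        then show ?thesis using dich[of "c / (a + b)"] that nz by simp
      qed
      define u v where "u = symb (a / (a + b))" and "v = symb (b / (a + b))"
      have "a / (a + b) \<noteq> 1" using b nz by (simp add: field_simps)
      moreover have "1 - a / (a + b) = b / (a + b)" using nz by (simp add: field_simps)
      ultimately have "u * v = 0"
        using steinberg[of "a / (a + b)"] a nz by (simp add: u_def v_def)
      \<comment> \<open>The two elements add up to u * v - [-1][-1], where u * v = 0.\<close>
      moreover have "(u - ?r) * v \<in> P" "?r * (v - ?r) \<in> P"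
        using quot[OF a] quot[OF b] ring_ideal_left[OF P] ring_ideal_right[OF P]
        by (auto simp: u_def v_def)
      from ring_ideal_add[OF P this] have "u * v - ?r * ?r \<in> P" by (simp add: algebra_simps)
      ultimately show False using rr ring_ideal_uminus[OF P, of "0 - ?r * ?r"] by simp
    qed
    ultimately show ?thesis ..
  qed
  have "symb a \<in> P \<or> symb (- a) \<in> P" if "a \<noteq> 0" for a
  proof (rule disjCI)
    assume "symb (- a) \<notin> P"
    then have "symb (- a) - ?r \<in> P" using dich[of "- a"] that by simp
    \<comment> \<open>The element [-a] - [-1] is <-1>[a], and <-1> is its own inverse.\<close>
    then have "ang (- 1) * (symb (- a) - ?r) \<in> P" by (rule ring_ideal_left[OF P])
    moreover have "symb (- a) - ?r = ang (- 1) * symb a"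
      using symb_mult_ang[of "- 1" a] that by simp
    ultimately show "symb a \<in> P"
      using ang_square[of "- 1 :: 'a"] by (simp flip: mult.assoc)
  qed
  with mult add show "positive_cone {a. a \<noteq> 0 \<and> symb a \<in> P}"
    by (auto simp: positive_cone_def)
qed

lemma of_int_left_commute: "of_int c * (y * z) = y * (of_int c * z :: 'r::ring_1)"
  by (metis mult.assoc mult_of_int_commute)

text \<open>
  Modulo \<open>Q\<close> the ring is generated by \<open>\<eta>\<close> and $[-1]$, whose product is an integer, so each
  degree is spanned by a single power of one of them.
\<close>

lemma KMW_residue:
  fixes Q :: "'a::field milnor_witt set"
  assumes Q: "ring_ideal Q"
    and symb: "\<And>a. a \<noteq> 0 \<Longrightarrow> symb a \<in> Q \<or> symb a - symb (- 1) \<in> Q"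
    and k: "eta * symb (- 1) - of_int k \<in> Q"
    and "x \<in> KMW n"
  shows "\<exists>c. x - of_int c * (symb (- 1) ^ nat n * eta ^ nat (- n)) \<in> Q"
  using assms(4)
proof (induction rule: KMW_induct)
  case (zero n)
  show ?case using ring_ideal_zero[OF Q] by (intro exI[of _ 0]) simp
next
  case one
  show ?case using ring_ideal_zero[OF Q] by (intro exI[of _ 1]) simp
next
  case (diff n x y)
  then obtain c d where "x - of_int c * (symb (- 1) ^ nat n * eta ^ nat (- n)) \<in> Q"
    "y - of_int d * (symb (- 1) ^ nat n * eta ^ nat (- n)) \<in> Q" by blast
  from ring_ideal_diff[OF Q this] show ?case
    by (intro exI[of _ "c - d"]) (simp add: algebra_simps)
next
  case (sym n a x)
  let ?r = "symb (- 1) :: 'a milnor_witt"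
  \<comment> \<open>As \<open>nat\<close> truncates at 0, \<open>?B n\<close> is a power of [-1] for
    n \<ge> 0 and a power of \<eta> for n \<le> 0.\<close>
  let ?B = "\<lambda>n. ?r ^ nat n * eta ^ nat (- n)"
  from sym obtain c where c: "x - of_int c * ?B n \<in> Q" by blast
  have step: "\<exists>d. ?r * ?B n - of_int d * ?B (n + 1) \<in> Q"
  proof (cases "n \<ge> 0")
    case True
    then have "?r * ?B n = ?B (n + 1)"
      by (simp add: nat_add_distrib)
    then show ?thesis using ring_ideal_zero[OF Q] by (intro exI[of _ 1]) simp
  next
    case False
    \<comment> \<open>For n < 0 the new factor [-1] meets one of the m + 1 factors \<eta>, and the
      pair is replaced by the integer k.\<close>
    define m where "m = nat (- n - 1)"
    have m: "nat (- n) = Suc m" "nat (- (n + 1)) = m" "nat n = 0" "nat (n + 1) = 0"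
      using False by (auto simp: m_def)
    have "?r * ?B n - of_int k * ?B (n + 1) = (eta * ?r - of_int k) * eta ^ m"
      using eta_commute[of ?r] by (simp only: m power_Suc power_0 mult_1_left left_diff_distrib mult.assoc[symmetric])
    then show ?thesis using ring_ideal_right[OF Q k] by metis
  qed
  then obtain d where d: "?r * ?B n - of_int d * ?B (n + 1) \<in> Q" by blast
  note x = ring_ideal_left[OF Q c, of "symb a"]
  from symb[OF sym(1)] show ?case
  proof
    assume "symb a \<in> Q"
    then have "symb a * x \<in> Q" by (rule ring_ideal_right[OF Q])
    then show ?thesis by (intro exI[of _ 0]) simp
  next
    assume a: "symb a - ?r \<in> Q"
    \<comment> \<open>Three successive corrections: x by its residue, [a] by [-1], and [-1]
      \<open>?B n\<close> by its multiple of \<open>?B (n + 1)\<close>.\<close>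
    have "symb a * (x - of_int c * ?B n) + (symb a - ?r) * (of_int c * ?B n) +
        of_int c * (?r * ?B n - of_int d * ?B (n + 1)) \<in> Q"
      by (intro ring_ideal_add[OF Q] x ring_ideal_right[OF Q a] ring_ideal_left[OF Q d])
    also have "symb a * (x - of_int c * ?B n) + (symb a - ?r) * (of_int c * ?B n) +
        of_int c * (?r * ?B n - of_int d * ?B (n + 1)) =
        symb a * x - of_int (c * d) * ?B (n + 1)"
      by (simp add: right_diff_distrib left_diff_distrib mult.assoc of_int_left_commute[of c ?r])
    finally show ?thesis ..
  qed
next
  case (eta n x)
  let ?r = "symb (- 1) :: 'a milnor_witt"
  let ?B = "\<lambda>n. ?r ^ nat n * eta ^ nat (- n)"
  from eta obtain c where c: "x - of_int c * ?B n \<in> Q" by blast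
  have "\<exists>d. eta * ?B n - of_int d * ?B (n - 1) \<in> Q"
  proof (cases "n \<le> 0")
    case True
    then have "nat (- (n - 1)) = Suc (nat (- n))" by simp
    with True have "eta * ?B n = ?B (n - 1)" by simp
    then show ?thesis using ring_ideal_zero[OF Q] by (intro exI[of _ 1]) simp
  next
    case False
    define m where "m = nat (n - 1)"
    have m: "nat (- n) = 0" "nat (- (n - 1)) = 0" "nat n = Suc m" "nat (n - 1) = m"
      using False by (auto simp: m_def)
    have "eta * ?B n - of_int k * ?B (n - 1) = (eta * ?r - of_int k) * ?r ^ m"
      by (simp only: m power_Suc power_0 mult_1_right left_diff_distrib mult.assoc)
    then show ?thesis using ring_ideal_right[OF Q k] by metis
  qed
  then obtain d where d: "eta * ?B n - of_int d * ?B (n - 1) \<in> Q" by blast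
  have "eta * (x - of_int c * ?B n) + of_int c * (eta * ?B n - of_int d * ?B (n - 1)) \<in> Q"
    by (intro ring_ideal_add[OF Q] ring_ideal_left[OF Q] c d)
  also have "eta * (x - of_int c * ?B n) + of_int c * (eta * ?B n - of_int d * ?B (n - 1)) =
      eta * x - of_int (c * d) * ?B (n - 1)"
    by (simp add: right_diff_distrib mult.assoc of_int_left_commute[of c eta])
  finally show ?case ..
qed

section \<open>Torsion elements lie in normal prime ideals\<close>

lemma ring_ideal_kernel: "is_ring_hom \<phi> \<Longrightarrow> ring_ideal {x. \<phi> x = 0}"
  by (simp add: ring_ideal_def is_ring_hom_simps)

lemma is_ring_hom_torsion:
  fixes \<phi> :: "'r::ring_1 \<Rightarrow> int"
  assumes "is_ring_hom \<phi>" "torsion_element x"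
  shows "\<phi> x = 0"
proof -
  from assms(2) obtain m where "m > 0" "of_nat m * x = 0" by (auto simp: torsion_element_def)
  then show ?thesis
    using is_ring_hom_simps(3)[OF assms(1), of "of_nat m" x] is_ring_hom_simps(8)[OF assms(1), of m]
      is_ring_hom_simps(4)[OF assms(1)] by simp
qed

lemma torsion_in_prime:
  fixes P :: "'a::field milnor_witt set"
  assumes normal_prime: "normal_prime_ideal P"
    and x: "x \<in> KMW n" "torsion_element x" and n: "n \<ge> 0 \<or> formally_real TYPE('a)"
  shows "x \<in> P"
proof -
  note P = normal_prime_ideal_ideal[OF normal_prime]
  note prime = normal_prime_idealD[OF normal_prime]
  show ?thesis
  proof (cases "symb (- 1) \<in> P")
    case False
    let ?r = "symb (- 1) :: 'a milnor_witt" and ?S = "{a. a \<noteq> 0 \<and> symb a \<in> P}"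
    note cone = positive_cone_of_ideal[OF normal_prime False]
    obtain \<phi> :: "'a milnor_witt \<Rightarrow> int" where \<phi>: "is_ring_hom \<phi>"
      "\<And>a. a \<noteq> 0 \<Longrightarrow> \<phi> (symb a) = (if a \<in> ?S then 0 else - 2)" "\<phi> eta = 1"
      using signature_hom_exists[OF cone(1)] by blast
    note hom = is_ring_hom_simps[OF \<phi>(1)]
    have r: "\<phi> ?r = - 2" using \<phi>(2)[of "- 1"] False by simp
    \<comment> \<open>Working modulo the intersection gives one integer c that serves both modulo P
      and for the signature.\<close>
    define Q where "Q = P \<inter> {x. \<phi> x = 0}"
    have Q: "ring_ideal Q" unfolding Q_def by (intro ring_ideal_Int P ring_ideal_kernel \<phi>(1))
    have "?r * hyp = 0" using hyp_commute[of ?r] by (simp add: hyp_symb_neg_one)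
    then have "hyp \<in> P"
      using prime[of ?r hyp] False symb_normal[of "- 1"] ring_ideal_zero[OF P] by auto
    \<comment> \<open>Modulo P this is h \<in> P, and the signature gives \<eta>[-1] the same value
      -2.\<close>
    then have "eta * ?r - of_int (- 2) \<in> Q"
      by (simp add: Q_def hyp_def hom r \<phi>(3) add.commute)
    moreover have "symb a \<in> Q \<or> symb a - ?r \<in> Q" if "a \<noteq> 0" for a
      using cone(2)[OF that] that by (auto simp: Q_def hom r \<phi>(2))
    ultimately obtain c where c: "x - of_int c * (?r ^ nat n * eta ^ nat (- n)) \<in> Q"
      using KMW_residue[OF Q _ _ x(1)] by metis
    then have "c * (- 2) ^ nat n = 0"
      using is_ring_hom_torsion[OF \<phi>(1) x(2)] by (simp add: Q_def hom r \<phi>(3))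
    with c show ?thesis by (simp add: Q_def)
  next
    case True
    let ?r = "symb (- 1) :: 'a milnor_witt"
    \<comment> \<open>Here [a][a] = [a][-1] lies in P, and [a] is normal.\<close>
    have symb: "symb a \<in> P" if "a \<noteq> 0" for a
      using prime[OF symb_normal[OF that], of "symb a"] ring_ideal_left[OF P True, of "symb a"]
      by (simp add: symb_square that)
    consider "n > 0" | "n = 0" | "n < 0" by linarith
    then show ?thesis
    proof cases
      case 1
      have "eta * ?r - of_int 0 \<in> P" using ring_ideal_left[OF P True] by simp
      then obtain c where "x - of_int c * (?r ^ nat n * eta ^ nat (- n)) \<in> P"
        using KMW_residue[OF P _ _ x(1)] symb by blast
      moreover have "?r ^ nat n \<in> P"
        using 1 ring_ideal_right[OF P True] by (cases "nat n") auto
      ultimately show ?thesis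
        using ring_ideal_cong[OF P] 1 ring_ideal_left[OF P, of "?r ^ nat n"] by auto
    next
      case 2
      obtain \<phi> :: "'a milnor_witt \<Rightarrow> int" where \<phi>: "is_ring_hom \<phi>"
        "\<And>a. a \<noteq> 0 \<Longrightarrow> \<phi> (symb a) = 0" "\<phi> eta = 0"
        using milnor_witt_hom_exists[of "\<lambda>_. 0 :: int" 0] by auto
      note hom = is_ring_hom_simps[OF \<phi>(1)]
      define Q where "Q = P \<inter> {x. \<phi> x = 0}"
      have Q: "ring_ideal Q" unfolding Q_def by (intro ring_ideal_Int P ring_ideal_kernel \<phi>(1))
      have symbQ: "symb a \<in> Q" if "a \<noteq> 0" for a using that by (simp add: Q_def \<phi> symb)
      have "eta * ?r - of_int 0 \<in> Q" using ring_ideal_left[OF Q symbQ[of "- 1"]] by simp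
      then obtain c where c: "x - of_int c * (?r ^ nat n * eta ^ nat (- n)) \<in> Q"
        using KMW_residue[OF Q _ _ x(1)] symbQ by blast
      then have "c = 0" using is_ring_hom_torsion[OF \<phi>(1) x(2)] 2 by (simp add: Q_def hom)
      with c show ?thesis by (simp add: Q_def)
    next
      case 3
      with n obtain S :: "'a set" where S: "positive_cone S" by (auto simp: formally_real_iff)
      obtain \<phi> :: "'a milnor_witt \<Rightarrow> int" where \<phi>: "is_ring_hom \<phi>"
        "\<And>a. a \<noteq> 0 \<Longrightarrow> \<phi> (symb a) = (if a \<in> S then 0 else - 2)" "\<phi> eta = 1"
        using signature_hom_exists[OF S] by blast
      note hom = is_ring_hom_simps[OF \<phi>(1)]
      \<comment> \<open>Symbols have signature 0 or -2, so they lie in Q only when the signature is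
        taken mod 2. As \<eta> has signature 1 and x has signature 0, c must be even.\<close>
      define Q where "Q = P \<inter> {x. even (\<phi> x)}"
      have Q: "ring_ideal Q"
        unfolding Q_def by (intro ring_ideal_Int P) (simp add: ring_ideal_def hom)
      have symbQ: "symb a \<in> Q" if "a \<noteq> 0" for a using that by (simp add: Q_def \<phi> symb)
      have "eta * ?r - of_int 0 \<in> Q" using ring_ideal_left[OF Q symbQ[of "- 1"]] by simp
      then obtain c where c: "x - of_int c * (?r ^ nat n * eta ^ nat (- n)) \<in> Q"
        using KMW_residue[OF Q _ _ x(1)] symbQ by blast
      then have "even c"
        using is_ring_hom_torsion[OF \<phi>(1) x(2)] 3 by (simp add: Q_def hom \<phi>(3))
      then obtain d where d: "c = 2 * d" by (elim evenE)
      \<comment> \<open>Since n < 0, at least one factor \<eta> is available to combine with the 2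
        in c; \<eta> h = 0 and [-1] \<in> P put 2\<eta> into P.\<close>
      define m where "m = nat (- n - 1)"
      have m: "nat (- n) = Suc m" using 3 by (simp add: m_def)
      have "2 * eta = - (eta * (eta * ?r))"
        using eta_hyp[where 'a = 'a] by (simp add: hyp_def distrib_left eq_neg_iff_add_eq_0 mult_2 mult_2_right)
      then have "2 * eta \<in> P"
        by (simp add: ring_ideal_left[OF P] ring_ideal_uminus[OF P] True)
      then have "of_int d * (2 * eta * eta ^ m) \<in> P"
        using ring_ideal_left[OF P] ring_ideal_right[OF P] by blast
      then have "of_int c * (?r ^ nat n * eta ^ nat (- n)) \<in> P"
        using 3 by (simp add: d m mult.assoc of_int_left_commute[of d 2])
      then show ?thesis using c ring_ideal_cong[OF P] by (auto simp: Q_def)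
    qed
  qed
qed

text \<open>If x were not nilpotent, its powers would avoid 0, so some normal prime ideal would
  avoid them all, in particular x itself.\<close>

lemma torsion_nilpotent:
  fixes x :: "'a::field milnor_witt"
  assumes "x \<in> KMW n" "torsion_element x" "n \<ge> 0 \<or> formally_real TYPE('a)"
  shows "nilpotent_element x"
proof (rule ccontr)
  assume not_nil: "\<not> ?thesis"
  obtain P where P: "normal_prime_ideal P" "P \<inter> range ((^) x) = {}"
    by (rule exists_normal_prime_ideal[of "range ((^) x)"])
      (use not_nil in \<open>auto simp: nilpotent_element_def simp flip: power_add\<close>)
  from torsion_in_prime[OF P(1) assms] P(2) show False
    using rangeI[of "(^) x" 1] by auto
qed

section \<open>Powers of \<eta> and fields that are not formally real\<close>

lemma eta_power_KMW: "eta ^ j \<in> KMW (- int j)"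
proof -
  have deg: "mw_word_degree w = - int j" if "w \<in> Poly_Mapping.keys (mw_eta ^ j)"
    for w :: "'a nonzero mw_generator gen_word"
  proof -
    have "mw_eta ^ j = frag_of (Gen_Word (replicate j (Eta :: 'a nonzero mw_generator)))"
    proof (induction j)
      case 0
      then show ?case by (simp add: zero_gen_word_def[symmetric])
    next
      case (Suc j)
      have "Gen_Word (replicate (Suc j) (Eta :: 'a nonzero mw_generator)) =
          Gen_Word [Eta] + Gen_Word (replicate j Eta)"
        by (simp add: plus_gen_word_def)
      then show ?case using Suc by (simp only: power_Suc frag_of_plus) (simp add: mw_eta_def generator_def)
    qed
    with that show ?thesis by (simp add: mw_word_degree_def sum_list_replicate)
  qed
  show ?thesis
    unfolding KMW_def eta_def abs_simps(7)[symmetric] using deg by blast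
qed

text \<open>With all symbols sent to 0 and \<eta> to 1, the hyperbolic relation becomes 2 = 0, which
  holds in Z/2.\<close>

lemma eta_not_nilpotent: "\<not> nilpotent_element (eta ^ j :: 'a::field milnor_witt)"
proof
  assume "nilpotent_element (eta ^ j :: 'a milnor_witt)"
  then obtain k where k: "(eta ^ j) ^ k = (0 :: 'a milnor_witt)"
    by (auto simp: nilpotent_element_def)
  obtain \<phi> :: "'a milnor_witt \<Rightarrow> bit" where \<phi>: "is_ring_hom \<phi>" "\<phi> eta = 1"
    by (rule milnor_witt_hom_exists[of "\<lambda>_. 0 :: bit" 1]) auto
  note hom = is_ring_hom_simps[OF \<phi>(1)]
  have "\<phi> ((eta ^ j) ^ k) = 1" by (simp add: hom \<phi>(2))
  with k show False by (simp add: hom)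
qed

text \<open>If no power of \<eta> is torsion, the products \<open>2 ^ k * eta ^ j\<close> are all
  nonzero, and a normal prime ideal avoiding them yields an ordering.\<close>

lemma eta_power_torsion:
  assumes "\<not> formally_real TYPE('a::field)"
  shows "\<exists>j. torsion_element (eta ^ j :: 'a milnor_witt)"
proof (rule ccontr)
  assume no: "\<not> ?thesis"
  let ?M = "{2 ^ k * eta ^ j | k j. True} :: 'a milnor_witt set"
  have two: "2 * y = y * 2" for y :: "'a milnor_witt" by (simp add: mult_2 mult_2_right)
  have "0 \<notin> ?M"
  proof
    assume "0 \<in> ?M"
    then obtain k j where "2 ^ k * eta ^ j = (0 :: 'a milnor_witt)" by auto
    then have "of_nat (2 ^ k) * eta ^ j = (0 :: 'a milnor_witt)" by simp
    with no show False unfolding torsion_element_def by (metis zero_less_power zero_less_numeral)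
  qed
  moreover have "x * y \<in> ?M" if "x \<in> ?M" "y \<in> ?M" for x y
  proof -
    from that obtain k j k' j' where xy: "x = 2 ^ k * eta ^ j" "y = 2 ^ k' * eta ^ j'" by auto
    have "2 ^ k' * eta ^ j = eta ^ j * (2 ^ k' :: 'a milnor_witt)"
      by (metis two power_commuting_commutes)
    then have "x * y = 2 ^ (k + k') * eta ^ (j + j')"
      by (simp add: xy power_add mult.assoc) (metis mult.assoc)
    then show ?thesis by auto
  qed
  ultimately obtain P where normal_prime: "normal_prime_ideal P" and PM: "P \<inter> ?M = {}"
    by (rule exists_normal_prime_ideal) auto
  note P = normal_prime_ideal_ideal[OF normal_prime]
  have M: "2 ^ k * eta ^ j \<notin> P" for k j using PM by blast
  have "eta \<in> P \<or> hyp \<in> P"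
    by (rule normal_prime_idealD[OF normal_prime eta_normal])
      (simp add: eta_hyp ring_ideal_zero[OF P])
  \<comment> \<open>The case k = 0, j = 1 says \<eta> \<notin> P, which leaves h \<in> P.\<close>
  then have hyp: "2 + eta * symb (- 1) \<in> P" using M[of 0 1] by (simp add: hyp_def)
  have "symb (- 1) \<notin> P"
  \<comment> \<open>With [-1] in P, h \<in> P would give 2 \<in> P, against the case k = 1, j =
    0.\<close>
  proof
    assume "symb (- 1) \<in> P"
    then have "2 + eta * symb (- 1) - eta * symb (- 1) \<in> P"
      by (intro ring_ideal_diff[OF P] ring_ideal_left[OF P] hyp)
    then show False using M[of 1 0] by simp
  qed
  from positive_cone_of_ideal(1)[OF normal_prime this] assms show False
    by (auto simp: formally_real_iff)
qed

theorem theorem1p4: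
  assumes "CHAR('a::field) \<noteq> 2"
  shows "(\<forall>n\<ge>0. nishida_nilpotence (KMW :: int \<Rightarrow> 'a milnor_witt set) n) \<and>
    ((\<forall>n. nishida_nilpotence (KMW :: int \<Rightarrow> 'a milnor_witt set) n)
      \<longleftrightarrow> formally_real TYPE('a))"
proof (intro conjI allI impI iffI)
  fix n :: int assume "n \<ge> 0"
  then show "nishida_nilpotence (KMW :: int \<Rightarrow> 'a milnor_witt set) n"
    unfolding nishida_nilpotence_def using torsion_nilpotent by blast
next
  assume all: "\<forall>n. nishida_nilpotence (KMW :: int \<Rightarrow> 'a milnor_witt set) n"
  show "formally_real TYPE('a)"
  proof (rule ccontr)
    assume "\<not> formally_real TYPE('a)"
    from eta_power_torsion[OF this] obtain j where "torsion_element (eta ^ j :: 'a milnor_witt)" ..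
    with all show False
      unfolding nishida_nilpotence_def using eta_power_KMW eta_not_nilpotent by blast
  qed
next
  fix n assume "formally_real TYPE('a)"
  then show "nishida_nilpotence (KMW :: int \<Rightarrow> 'a milnor_witt set) n"
    unfolding nishida_nilpotence_def using torsion_nilpotent by blast
qed

end
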